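(* Let $r\ge1$, let $\alpha_1,\dots,\alpha_r\in\mathbb C$ be pairwise distinct and let $w_1,\dots,w_r\in\mathbb C\setminus\{0\}$ (independent of $q$). Let $\Gamma\subset\mathbb C$ be a fixed simple closed $C^1$ contour containing $1$ in its interior, and put $d_\Gamma=\min_{z\in\Gamma}|1-z|>0$. Then, as $q\to1$ through positive real values, $$\mu_q(\Gamma)=C_\Gamma|\log q|^{r(r-1)}(1+o(1)),$$ where $$C_\Gamma=\left|\prod_{\ell=1}^{r}w_\ell\right|\prod_{1\le k<\ell\le r}|\alpha_\ell-\alpha_k|^2\,d_\Gamma^{\,r}.$$
   Context: For $q>0$, $\rho_\ell(q)=q^{\alpha_\ell}=e^{\alpha_\ell\log q}$, $\mu_n^{(q)}=\sum_{\ell=1}^r w_\ell\rho_\ell(q)^n$ for $n\ge0$, and $H_{r,s}^{(q)}=(\mu_{i+j+s}^{(q)})_{i,j=0}^{r-1}$ for $s=0,1$. Put $\Psi_q(z)=\det(H_{r,1}^{(q)}-zH_{r,0}^{(q)})$. The contour margin is $\mu_q(\Gamma)=\min_{z\in\Gamma}|\Psi_q(z)|$ (not to be confused with the moments $\mu_n^{(q)}$). *)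

theory Defs
  imports "HOL-Analysis.Analysis" "HOL-Library.Landau_Symbols"
    "Jordan_Normal_Form.Determinant"
begin

(* The weights w and the exponents \<alpha> are families indexed by {1..r}; their values
   outside that range are irrelevant. Matrices and determinants are those of
   Jordan_Normal_Form, whose dimension r is an ordinary natural number and whose
   entries are indexed from 0. *)

definition node :: "(nat \<Rightarrow> complex) \<Rightarrow> real \<Rightarrow> nat \<Rightarrow> complex" where
  "node \<alpha> q l = exp (\<alpha> l * of_real (ln q))"

definition moment :: "nat \<Rightarrow> (nat \<Rightarrow> complex) \<Rightarrow> (nat \<Rightarrow> complex) \<Rightarrow> real \<Rightarrow> nat \<Rightarrow> complex" where
  "moment r w \<alpha> q n = (\<Sum>l = 1..r. w l * node \<alpha> q l ^ n)"

definition hankel ::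
  "nat \<Rightarrow> (nat \<Rightarrow> complex) \<Rightarrow> (nat \<Rightarrow> complex) \<Rightarrow> real \<Rightarrow> nat \<Rightarrow> complex Matrix.mat" where
  "hankel r w \<alpha> q s = Matrix.mat r r (\<lambda>(i, j). moment r w \<alpha> q (i + j + s))"

definition pencil_det ::
  "nat \<Rightarrow> (nat \<Rightarrow> complex) \<Rightarrow> (nat \<Rightarrow> complex) \<Rightarrow> real \<Rightarrow> complex \<Rightarrow> complex" where
  "pencil_det r w \<alpha> q z =
     Determinant.det (hankel r w \<alpha> q 1 - z \<cdot>\<^sub>m hankel r w \<alpha> q 0)"

(* The least value of f on a possibly infinite set S, where Min is not available.
   It is meaningful only if a least value exists; see minimum_on_attained. *)
definition minimum_on :: "('a \<Rightarrow> real) \<Rightarrow> 'a set \<Rightarrow> real" where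
  "minimum_on f S = (LEAST m. m \<in> f ` S)"

lemma minimum_on_attained:
  fixes f :: "'a::topological_space \<Rightarrow> real"
  assumes "compact S" "S \<noteq> {}" "continuous_on S f"
  obtains x where "x \<in> S" "minimum_on f S = f x" "\<And>y. y \<in> S \<Longrightarrow> minimum_on f S \<le> f y"
proof -
  obtain x where x: "x \<in> S" "\<And>y. y \<in> S \<Longrightarrow> f x \<le> f y"
    using continuous_attains_inf[OF assms] by blast
  have "minimum_on f S = f x"
    unfolding minimum_on_def by (rule Least_equality) (use x in auto)
  then show ?thesis using x that by metis
qed

definition contour_margin ::
  "nat \<Rightarrow> (nat \<Rightarrow> complex) \<Rightarrow> (nat \<Rightarrow> complex) \<Rightarrow> complex set \<Rightarrow> real \<Rightarrow> real" where
  "contour_margin r w \<alpha> \<Gamma> q = minimum_on (\<lambda>z. cmod (pencil_det r w \<alpha> q z)) \<Gamma>"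

definition contour_dist :: "complex set \<Rightarrow> real" where
  "contour_dist \<Gamma> = minimum_on (\<lambda>z. cmod (1 - z)) \<Gamma>"

definition margin_const ::
  "nat \<Rightarrow> (nat \<Rightarrow> complex) \<Rightarrow> (nat \<Rightarrow> complex) \<Rightarrow> complex set \<Rightarrow> real" where
  "margin_const r w \<alpha> \<Gamma> =
     cmod (\<Prod>l = 1..r. w l)
     * (\<Prod>(k, l) \<in> {(k, l). 1 \<le> k \<and> k < l \<and> l \<le> r}. (cmod (\<alpha> l - \<alpha> k))\<^sup>2)
     * contour_dist \<Gamma> ^ r"

(* The derivative is one-sided at the two ends of the parameter interval, unlike in
   the library's C1_differentiable_on. It is not required to be nonzero, and its values
   at the two ends need not agree. *)
definition simple_closed_C1_contour :: "complex set \<Rightarrow> bool" where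
  "simple_closed_C1_contour \<Gamma> \<longleftrightarrow>
     (\<exists>g g'. simple_path g \<and> pathfinish g = pathstart g \<and> path_image g = \<Gamma> \<and>
        (\<forall>t\<in>{0..1}. (g has_vector_derivative g' t) (at t within {0..1})) \<and>
        continuous_on {0..1} g')"

end

theory Submission
  imports Defs
begin

text \<open>
  The Hankel pencil is a congruence transform of a diagonal matrix: its entry
  \<open>\<mu>\<^bsub>i+j+1\<^esub> - z \<mu>\<^bsub>i+j\<^esub> = (\<Sum>l. w\<^sub>l (\<rho>\<^sub>l - z) \<rho>\<^sub>l\<^bsup>i\<^esup> \<rho>\<^sub>l\<^bsup>j\<^esup>)\<close> is that of \<open>V\<^sup>T D V\<close>, where
  \<open>V\<close> is the Vandermonde matrix of the nodes \<open>\<rho>\<^sub>l\<close> and \<open>D\<close> has the diagonal entries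
  \<open>w\<^sub>l (\<rho>\<^sub>l - z)\<close>. Taking determinants splits \<open>\<Psi>\<^sub>q(z)\<close> exactly into three factors: the product
  of the weights, the squared Vandermonde product of the nodes, and \<open>(\<Prod>l. \<rho>\<^sub>l - z)\<close>
  (\<open>pencil_det_factorization\<close>). Only the last one depends on \<open>z\<close>, so the margin is the
  modulus of the first two times the minimum of the modulus of the last one over the contour.

  Two limits remain. Since \<open>\<rho>\<^sub>l = exp (\<alpha>\<^sub>l log q)\<close>, each difference \<open>\<rho>\<^sub>l - \<rho>\<^sub>k\<close> is
  asymptotic to \<open>(\<alpha>\<^sub>l - \<alpha>\<^sub>k) log q\<close> (\<open>tendsto_node_diff_quotient\<close>). The \<open>r(r-1)/2\<close> pairs, each
  squared, contribute \<open>|log q|\<^bsup>r(r-1)\<^esup>\<close>. All nodes tend to 1, so the minimum of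
  \<open>(\<Prod>l. |\<rho>\<^sub>l - z|)\<close> tends to the \<open>r\<close>-th power of the distance from 1 to the contour
  (\<open>tendsto_minimum_on_prod_dist\<close>). The limit constant is nonzero because the exponents are
  distinct, the weights are nonzero and 1 lies off the contour; hence convergence of the
  quotient is the same as the asymptotic formula with relative error \<open>o(1)\<close>.
\<close>

section \<open>Determinants of Vandermonde and Hankel matrices\<close>

definition vandermonde_mat :: "nat \<Rightarrow> (nat \<Rightarrow> 'a::comm_ring_1) \<Rightarrow> 'a Matrix.mat" where
  "vandermonde_mat n x = Matrix.mat n n (\<lambda>(i, j). x i ^ j)"

text \<open>
  Multiplying the Vandermonde matrix by a change of basis from the monomials to the Newton
  polynomials \<open>p\<^sub>j = (\<Prod>k<j. X - x\<^sub>k)\<close> leaves the determinant unchanged, because each \<open>p\<^sub>j\<close> is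
  monic of degree \<open>j\<close>. The product has the entries \<open>p\<^sub>j(x\<^sub>i)\<close>; these vanish for \<open>i < j\<close>, so its
  determinant can be read off the diagonal.
\<close>

lemma det_vandermonde:
  fixes x :: "nat \<Rightarrow> 'a::idom"
  shows "Determinant.det (vandermonde_mat n x) = (\<Prod>i<n. \<Prod>k<i. x i - x k)"
proof -
  define p where "p j = (\<Prod>k<j. [:- x k, 1:])" for j
  have deg_p: "degree (p j) = j" and monic_p: "coeff (p j) j = 1" for j
  proof -
    show deg: "degree (p j) = j"
      unfolding p_def by (subst degree_prod_eq_sum_degree) auto
    have "lead_coeff (p j) = 1"
      unfolding p_def by (simp add: lead_coeff_prod)
    then show "coeff (p j) j = 1" by (simp add: deg)
  qed
  have poly_p: "poly (p j) y = (\<Prod>k<j. y - x k)" for j y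
    by (simp add: p_def poly_prod)
  define U where "U = Matrix.mat n n (\<lambda>(k, j). coeff (p j) k)"
  define N where "N = Matrix.mat n n (\<lambda>(i, j). poly (p j) (x i))"
  have U: "U \<in> carrier_mat n n" and V: "vandermonde_mat n x \<in> carrier_mat n n"
    and N: "N \<in> carrier_mat n n"
    by (simp_all add: U_def vandermonde_mat_def N_def)
  have "vandermonde_mat n x * U = N"
  proof (rule eq_matI)
    fix i j assume "i < dim_row N" "j < dim_col N"
    then have ij: "i < n" "j < n" using N by auto
    have "(vandermonde_mat n x * U) $$ (i, j) = (\<Sum>k<n. x i ^ k * coeff (p j) k)"
      using ij by (simp add: vandermonde_mat_def U_def scalar_prod_def atLeast0LessThan)
    also have "\<dots> = (\<Sum>k\<le>j. x i ^ k * coeff (p j) k)"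
      using ij deg_p by (intro sum.mono_neutral_right) (auto intro!: coeff_eq_0)
    also have "\<dots> = N $$ (i, j)"
      using ij by (simp add: N_def poly_altdef deg_p mult.commute)
    finally show "(vandermonde_mat n x * U) $$ (i, j) = N $$ (i, j)" .
  qed (use U V N in auto)
  moreover have "Determinant.det U = 1"
  proof -
    have "upper_triangular U" 
      by (rule upper_triangularI) (simp add: U_def deg_p coeff_eq_0)
    then show ?thesis using U
      by (simp add: det_upper_triangular prod_list_diag_prod) (simp add: U_def monic_p)
  qed
  moreover have "Determinant.det N = (\<Prod>i<n. \<Prod>k<i. x i - x k)"
  proof -
    have "N $$ (i, j) = 0" if "i < j" "j < n" for i j
      using that by (auto simp: N_def poly_p)
    then show ?thesis using N
      by (simp add: det_lower_triangular[of n] prod_list_diag_prod)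
        (simp add: N_def poly_p atLeast0LessThan)
  qed
  ultimately show ?thesis using det_mult[OF V U] by simp
qed

text \<open>
  The matrix is \<open>V\<^sup>T D V\<close> with \<open>V\<close> the Vandermonde matrix of \<open>x\<close> and \<open>D\<close> the diagonal matrix
  of \<open>c\<close>, since \<open>x\<^sub>l\<^bsup>i+j\<^esup> = x\<^sub>l\<^bsup>i\<^esup> x\<^sub>l\<^bsup>j\<^esup>\<close>.
\<close>

lemma det_hankel_exponential_sum:
  fixes x c :: "nat \<Rightarrow> 'a::idom"
  shows "Determinant.det (Matrix.mat n n (\<lambda>(i, j). \<Sum>l<n. c l * x l ^ (i + j))) =
    (\<Prod>l<n. c l) * (\<Prod>i<n. \<Prod>k<i. (x i - x k)\<^sup>2)" (is "Determinant.det ?H = _")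
proof -
  let ?V = "vandermonde_mat n x"
  define D where "D = Matrix.mat n n (\<lambda>(i, j). if i = j then c i else 0)"
  have D: "D \<in> carrier_mat n n" and V: "?V \<in> carrier_mat n n"
    by (simp_all add: D_def vandermonde_mat_def)
  have DV: "(D * ?V) $$ (l, j) = c l * x l ^ j" if "l < n" "j < n" for l j
    using that by (simp add: D_def vandermonde_mat_def scalar_prod_def if_distrib[of "\<lambda>a. a * _"]
        cong: if_cong)
  have "?H = transpose_mat ?V * (D * ?V)"
  proof (rule eq_matI)
    fix i j assume "i < dim_row (transpose_mat ?V * (D * ?V))" "j < dim_col (transpose_mat ?V * (D * ?V))"
    then have ij: "i < n" "j < n" using V D by auto
    have "(transpose_mat ?V * (D * ?V)) $$ (i, j) = (\<Sum>l<n. ?V $$ (l, i) * (D * ?V) $$ (l, j))"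
      using ij V D by (simp add: scalar_prod_def atLeast0LessThan)
    also have "\<dots> = (\<Sum>l<n. c l * x l ^ (i + j))"
      using ij by (intro sum.cong) (auto simp: DV, simp add: vandermonde_mat_def power_add mult_ac)
    finally show "?H $$ (i, j) = (transpose_mat ?V * (D * ?V)) $$ (i, j)"
      using ij by simp
  qed (use D V in auto)
  moreover have "Determinant.det D = (\<Prod>l<n. c l)"
  proof -
    have "upper_triangular D" by (auto simp: D_def)
    then show ?thesis using D
      by (simp add: det_upper_triangular prod_list_diag_prod) (simp add: D_def atLeast0LessThan)
  qed
  ultimately show ?thesis
    using V D det_mult[of "transpose_mat ?V" n "D * ?V"] det_mult[of D n ?V]
    by (simp add: det_transpose[of _ n] det_vandermonde power2_eq_square prod.distrib mult_ac)
qed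

section \<open>Factorization of the pencil determinant\<close>

text \<open>
  This passes between the 1-based families of nodes and the 0-based indices of matrix rows.
\<close>

lemma prod_pairs_nested:
  fixes f :: "nat \<Rightarrow> nat \<Rightarrow> 'a::comm_monoid_mult"
  shows "(\<Prod>(k, l) \<in> {(k, l). 1 \<le> k \<and> k < l \<and> l \<le> r}. f k l) =
    (\<Prod>i<r. \<Prod>k<i. f (Suc k) (Suc i))"
proof -
  have "(\<Prod>i<r. \<Prod>k<i. f (Suc k) (Suc i)) =
      (\<Prod>(i, k) \<in> (SIGMA i:{..<r}. {..<i}). f (Suc k) (Suc i))"
    by (simp add: prod.Sigma)
  also have "\<dots> = (\<Prod>(k, l) \<in> {(k, l). 1 \<le> k \<and> k < l \<and> l \<le> r}. f k l)"
    by (rule prod.reindex_bij_witness[where i = "\<lambda>(k, l). (l - 1, k - 1)" and j = "\<lambda>(i, k). (Suc k, Suc i)"])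
      auto
  finally show ?thesis ..
qed

lemma pencil_det_factorization:
  "pencil_det r w \<alpha> q z =
    (\<Prod>l = 1..r. w l)
    * (\<Prod>(k, l) \<in> {(k, l). 1 \<le> k \<and> k < l \<and> l \<le> r}. (node \<alpha> q l - node \<alpha> q k)\<^sup>2)
    * (\<Prod>l = 1..r. node \<alpha> q l - z)"
proof -
  define x where "x i = node \<alpha> q (Suc i)" for i
  define c where "c i = w (Suc i) * (x i - z)" for i
  have shift: "(\<Sum>l = 1..r. g l) = (\<Sum>l<r. g (Suc l))" "(\<Prod>l = 1..r. g l) = (\<Prod>l<r. g (Suc l))"
    for g :: "nat \<Rightarrow> complex"
    using sum.atLeast1_atMost_eq[of g r] prod.atLeast1_atMost_eq[of g r] by simp_all
  have "hankel r w \<alpha> q 1 - z \<cdot>\<^sub>m hankel r w \<alpha> q 0 =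
      Matrix.mat r r (\<lambda>(i, j). \<Sum>l<r. c l * x l ^ (i + j))"
    by (rule eq_matI)
      (auto simp: hankel_def moment_def shift c_def x_def sum_distrib_left algebra_simps power_add
        simp flip: sum_subtractf simp del: One_nat_def)
  then show ?thesis
    unfolding pencil_det_def prod_pairs_nested shift
    by (simp add: det_hankel_exponential_sum) (simp add: c_def x_def prod.distrib)
qed

section \<open>Minima over the contour\<close>

lemma minimum_on_mult_left:
  fixes f :: "'a::topological_space \<Rightarrow> real"
  assumes "compact S" "S \<noteq> {}" "continuous_on S f" "a \<ge> 0"
  shows "minimum_on (\<lambda>x. a * f x) S = a * minimum_on f S"
proof -
  obtain x where x: "x \<in> S" "minimum_on f S = f x" "\<And>y. y \<in> S \<Longrightarrow> minimum_on f S \<le> f y"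
    using minimum_on_attained[OF assms(1-3)] by blast
  show ?thesis
    unfolding minimum_on_def[of "\<lambda>x. a * f x"]
    by (rule Least_equality) (use x assms(4) in \<open>auto intro: mult_left_mono\<close>)
qed

text \<open>
  If \<open>d\<close> is the distance from \<open>c\<close> to \<open>S\<close> and \<open>\<delta>\<^sub>l = |\<rho>\<^sub>l - c|\<close>, the triangle inequality puts the
  minimum between \<open>(\<Prod>l. max 0 (d - \<delta>\<^sub>l))\<close>, a lower bound at every point of \<open>S\<close>, and
  \<open>(\<Prod>l. d + \<delta>\<^sub>l)\<close>, an upper bound at the point of \<open>S\<close> nearest to \<open>c\<close>. Truncation at 0 keeps
  the factors nonnegative, so that they can be multiplied for all values of the parameter.
\<close>

lemma tendsto_minimum_on_prod_dist:
  fixes \<rho> :: "'b \<Rightarrow> 'i \<Rightarrow> 'a::real_normed_vector"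
  assumes S: "compact S" "S \<noteq> {}"
    and lim: "\<And>l. l \<in> I \<Longrightarrow> ((\<lambda>q. \<rho> q l) \<longlongrightarrow> c) F"
  shows "((\<lambda>q. minimum_on (\<lambda>z. \<Prod>l\<in>I. norm (\<rho> q l - z)) S) \<longlongrightarrow>
    minimum_on (\<lambda>z. norm (c - z)) S ^ card I) F"
proof -
  let ?d = "minimum_on (\<lambda>z. norm (c - z)) S"
  obtain z0 where z0: "z0 \<in> S" "?d = norm (c - z0)" "\<And>z. z \<in> S \<Longrightarrow> ?d \<le> norm (c - z)"
    by (rule minimum_on_attained[OF S, of "\<lambda>z. norm (c - z)"])
      (auto intro!: continuous_on_norm continuous_on_diff continuous_on_const continuous_on_id)
  have lim0: "((\<lambda>q. norm (\<rho> q l - c)) \<longlongrightarrow> 0) F" if "l \<in> I" for l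
    using lim[OF that] by (simp add: tendsto_norm_zero LIM_zero)
  have bounds: "(\<Prod>l\<in>I. max 0 (?d - norm (\<rho> q l - c))) \<le> minimum_on (\<lambda>z. \<Prod>l\<in>I. norm (\<rho> q l - z)) S
      \<and> minimum_on (\<lambda>z. \<Prod>l\<in>I. norm (\<rho> q l - z)) S \<le> (\<Prod>l\<in>I. ?d + norm (\<rho> q l - c))" for q
  proof -
    have "continuous_on S (\<lambda>z. \<Prod>l\<in>I. norm (\<rho> q l - z))" by (intro continuous_intros)
    then obtain z1 where z1: "z1 \<in> S"
      "minimum_on (\<lambda>z. \<Prod>l\<in>I. norm (\<rho> q l - z)) S = (\<Prod>l\<in>I. norm (\<rho> q l - z1))"
      "\<And>z. z \<in> S \<Longrightarrow> minimum_on (\<lambda>z. \<Prod>l\<in>I. norm (\<rho> q l - z)) S \<le> (\<Prod>l\<in>I. norm (\<rho> q l - z))"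
      using minimum_on_attained[OF S] by blast
    have "?d \<le> norm (\<rho> q l - z1) + norm (\<rho> q l - c)" for l
      using z0(3)[OF z1(1)] norm_triangle_ineq[of "\<rho> q l - z1" "c - \<rho> q l"]
      by (simp add: norm_minus_commute)
    then have "(\<Prod>l\<in>I. max 0 (?d - norm (\<rho> q l - c))) \<le> (\<Prod>l\<in>I. norm (\<rho> q l - z1))"
      by (intro prod_mono) (auto simp: diff_le_eq)
    moreover have "norm (\<rho> q l - z0) \<le> ?d + norm (\<rho> q l - c)" for l
      using norm_triangle_ineq[of "\<rho> q l - c" "c - z0"] z0(2) by simp
    then have "(\<Prod>l\<in>I. norm (\<rho> q l - z0)) \<le> (\<Prod>l\<in>I. ?d + norm (\<rho> q l - c))"
      by (intro prod_mono) auto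
    ultimately show ?thesis using z1(2) z1(3)[OF z0(1)] by linarith
  qed
  have "((\<lambda>q. \<Prod>l\<in>I. max 0 (?d - norm (\<rho> q l - c))) \<longlongrightarrow> (\<Prod>l\<in>I. max 0 (?d - 0))) F"
    by (intro tendsto_prod tendsto_max tendsto_diff tendsto_const lim0)
  moreover have "((\<lambda>q. \<Prod>l\<in>I. ?d + norm (\<rho> q l - c)) \<longlongrightarrow> (\<Prod>l\<in>I. ?d + 0)) F"
    by (intro tendsto_prod tendsto_add tendsto_const lim0)
  moreover have "?d \<ge> 0" using z0(2) by simp
  ultimately have low: "((\<lambda>q. \<Prod>l\<in>I. max 0 (?d - norm (\<rho> q l - c))) \<longlongrightarrow> ?d ^ card I) F"
    and up: "((\<lambda>q. \<Prod>l\<in>I. ?d + norm (\<rho> q l - c)) \<longlongrightarrow> ?d ^ card I) F"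
    by simp_all
  show ?thesis
    by (rule tendsto_sandwich[OF _ _ low up]) (use bounds in auto)
qed

section \<open>Behaviour of the nodes near 1\<close>

lemma filterlim_ln_at_0: "filterlim ln (at (0::real)) (at 1 within {0<..})"
proof -
  have "(ln \<longlongrightarrow> ln 1) (at 1 within {0::real<..})"
    by (intro tendsto_ln tendsto_ident_at) auto
  moreover have "\<forall>\<^sub>F q in at 1 within {0<..}. ln q \<noteq> (0::real)"
    by (auto simp: eventually_at_filter)
  ultimately show ?thesis by (simp add: filterlim_at)
qed

lemma tendsto_node: "((\<lambda>q. node \<alpha> q l) \<longlongrightarrow> 1) (at 1 within {0<..})"
proof -
  have "(ln \<longlongrightarrow> 0) (at 1 within {0::real<..})"
    using filterlim_ln_at_0 by (simp add: filterlim_at)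
  then have "((\<lambda>q. exp (\<alpha> l * of_real (ln q))) \<longlongrightarrow> exp (\<alpha> l * of_real 0)) (at 1 within {0<..})"
    by (intro tendsto_intros)
  then show ?thesis by (simp add: node_def)
qed

text \<open>
  The quotient is the modulus of the difference quotient at \<open>t = 0\<close> of
  \<open>exp (\<alpha>\<^sub>l t) - exp (\<alpha>\<^sub>k t)\<close>, taken at \<open>t = log q\<close>.
\<close>

lemma tendsto_node_diff_quotient:
  "((\<lambda>q. cmod (node \<alpha> q l - node \<alpha> q k) / \<bar>ln q\<bar>) \<longlongrightarrow> cmod (\<alpha> l - \<alpha> k)) (at 1 within {0<..})"
proof -
  let ?f = "\<lambda>t. exp (\<alpha> l * t) - exp (\<alpha> k * t)"
  have "(?f has_field_derivative \<alpha> l - \<alpha> k) (at 0)"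
    by (auto intro!: derivative_eq_intros)
  then have "((\<lambda>t. ?f t / t) \<longlongrightarrow> \<alpha> l - \<alpha> k) (at 0)"
    by (simp add: has_field_derivative_iff)
  moreover have "filterlim (\<lambda>q. complex_of_real (ln q)) (at 0) (at 1 within {0<..})"
  proof -
    have "(ln \<longlongrightarrow> 0) (at 1 within {0::real<..})" "\<forall>\<^sub>F q in at 1 within {0<..}. ln q \<noteq> (0::real)"
      using filterlim_ln_at_0 by (simp_all add: filterlim_at)
    then show ?thesis by (auto simp: filterlim_at intro!: tendsto_eq_intros)
  qed
  ultimately have "((\<lambda>q. ?f (of_real (ln q)) / of_real (ln q)) \<longlongrightarrow> \<alpha> l - \<alpha> k) (at 1 within {0<..})"
    by (rule filterlim_compose)
  then show ?thesis by (auto dest: tendsto_norm simp: node_def norm_divide)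
qed

text \<open>
  The exponent is twice the number \<open>r(r-1)/2\<close> of pairs; this is where the order of vanishing
  of the margin comes from.
\<close>

lemma prod_pairs_power2_scaled:
  fixes f :: "nat \<Rightarrow> nat \<Rightarrow> 'a::field"
  assumes "t \<noteq> 0"
  shows "(\<Prod>(k, l) \<in> {(k, l). 1 \<le> k \<and> k < l \<and> l \<le> r}. (f k l / t)\<^sup>2) * t ^ (r * (r - 1)) =
    (\<Prod>(k, l) \<in> {(k, l). 1 \<le> k \<and> k < l \<and> l \<le> r}. (f k l)\<^sup>2)"
proof -
  have "(\<Prod>i<r. \<Prod>k<i. t\<^sup>2) = t ^ (r * (r - 1))"
  proof (induction r)
    case (Suc r)
    have "r * (r - 1) + 2 * r = Suc r * (Suc r - 1)" by (cases r) auto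
    then have "t ^ (Suc r * (Suc r - 1)) = t ^ (r * (r - 1)) * (t\<^sup>2) ^ r"
      by (metis power_add power_mult)
    then show ?case using Suc by simp
  qed simp
  then show ?thesis
    using assms unfolding prod_pairs_nested by (simp add: power_divide prod_dividef)
qed

section \<open>The contour margin\<close>

lemma compact_contour:
  assumes "simple_closed_C1_contour \<Gamma>"
  shows "compact \<Gamma>" "\<Gamma> \<noteq> {}"
  using assms unfolding simple_closed_C1_contour_def
  by (auto intro: compact_simple_path_image simp: path_image_nonempty)

lemma contour_margin_eq:
  assumes "compact \<Gamma>" "\<Gamma> \<noteq> {}"
  shows "contour_margin r w \<alpha> \<Gamma> q =
    cmod (\<Prod>l = 1..r. w l)
    * (\<Prod>(k, l) \<in> {(k, l). 1 \<le> k \<and> k < l \<and> l \<le> r}. (cmod (node \<alpha> q l - node \<alpha> q k))\<^sup>2)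
    * minimum_on (\<lambda>z. \<Prod>l = 1..r. cmod (node \<alpha> q l - z)) \<Gamma>"
proof -
  let ?A = "cmod (\<Prod>l = 1..r. w l)
    * (\<Prod>(k, l) \<in> {(k, l). 1 \<le> k \<and> k < l \<and> l \<le> r}. (cmod (node \<alpha> q l - node \<alpha> q k))\<^sup>2)"
  have "cmod (pencil_det r w \<alpha> q z) = ?A * (\<Prod>l = 1..r. cmod (node \<alpha> q l - z))" for z
    by (simp add: pencil_det_factorization norm_mult prod_norm norm_power case_prod_unfold
        flip: prod_norm)
  moreover have "?A \<ge> 0" by (intro mult_nonneg_nonneg prod_nonneg) auto
  moreover have "continuous_on \<Gamma> (\<lambda>z. \<Prod>l = 1..r. cmod (node \<alpha> q l - z))"
    by (intro continuous_intros)
  ultimately show ?thesis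
    unfolding contour_margin_def by (simp add: minimum_on_mult_left[OF assms])
qed

theorem corollary4p7:
  fixes r :: nat and \<alpha> w :: "nat \<Rightarrow> complex" and \<Gamma> :: "complex set"
  assumes "r \<ge> 1"
    and "inj_on \<alpha> {1..r}"
    and "\<And>l. l \<in> {1..r} \<Longrightarrow> w l \<noteq> 0"
    and "simple_closed_C1_contour \<Gamma>"
    and "1 \<in> inside \<Gamma>"
  shows "contour_dist \<Gamma> > 0 \<and>
    (\<exists>\<epsilon> :: real \<Rightarrow> real. \<epsilon> \<in> o[at 1 within {0<..}](\<lambda>_. 1) \<and>
      (\<forall>\<^sub>F q in at 1 within {0<..}.
         contour_margin r w \<alpha> \<Gamma> q =
           margin_const r w \<alpha> \<Gamma> * \<bar>ln q\<bar> ^ (r * (r - 1)) * (1 + \<epsilon> q)))"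
proof
  note \<Gamma> = compact_contour[OF assms(4)]
  have "1 \<notin> \<Gamma>" using assms(5) by (auto simp: inside_def)
  obtain z0 where "z0 \<in> \<Gamma>" "contour_dist \<Gamma> = cmod (1 - z0)"
    unfolding contour_dist_def
    by (rule minimum_on_attained[OF \<Gamma>, of "\<lambda>z. cmod (1 - z)"]) (auto intro!: continuous_on_norm continuous_on_diff continuous_on_const continuous_on_id)
  then show dist_pos: "contour_dist \<Gamma> > 0" using \<open>1 \<notin> \<Gamma>\<close> by auto
  let ?P = "{(k, l). 1 \<le> k \<and> k < l \<and> l \<le> r}"
  let ?F = "at 1 within {0<..} :: real filter"
  let ?C = "margin_const r w \<alpha> \<Gamma>"
  have C: "?C \<noteq> 0"
  proof -
    have "finite ?P" by (rule finite_subset[of _ "{1..r} \<times> {1..r}"]) auto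
    moreover have "\<alpha> l \<noteq> \<alpha> k" if "(k, l) \<in> ?P" for k l
      using that inj_onD[OF assms(2), of l k] by auto
    ultimately show ?thesis
      using assms(3) dist_pos by (auto simp: margin_const_def)
  qed
  \<comment> \<open>The relative error will be \<open>R q / ?C - 1\<close>, so it suffices that \<open>R q\<close> tends to \<open>?C\<close>.\<close>
  define R where "R q = contour_margin r w \<alpha> \<Gamma> q / \<bar>ln q\<bar> ^ (r * (r - 1))" for q
  have nz: "\<forall>\<^sub>F q in ?F. ln q \<noteq> 0"
    using filterlim_ln_at_0 by (simp add: filterlim_at)
  have "((\<lambda>q. cmod (\<Prod>l = 1..r. w l)
      * (\<Prod>(k, l) \<in> ?P. (cmod (node \<alpha> q l - node \<alpha> q k) / \<bar>ln q\<bar>)\<^sup>2)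
      * minimum_on (\<lambda>z. \<Prod>l = 1..r. cmod (node \<alpha> q l - z)) \<Gamma>) \<longlongrightarrow>
      cmod (\<Prod>l = 1..r. w l) * (\<Prod>(k, l) \<in> ?P. (cmod (\<alpha> l - \<alpha> k))\<^sup>2)
      * minimum_on (\<lambda>z. cmod (1 - z)) \<Gamma> ^ card {1..r}) ?F"
    unfolding case_prod_unfold
    by (intro tendsto_mult tendsto_const tendsto_prod tendsto_power tendsto_node_diff_quotient
        tendsto_minimum_on_prod_dist \<Gamma> tendsto_node)
  moreover have "\<forall>\<^sub>F q in ?F. cmod (\<Prod>l = 1..r. w l)
      * (\<Prod>(k, l) \<in> ?P. (cmod (node \<alpha> q l - node \<alpha> q k) / \<bar>ln q\<bar>)\<^sup>2)
      * minimum_on (\<lambda>z. \<Prod>l = 1..r. cmod (node \<alpha> q l - z)) \<Gamma> = R q"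
    using nz
  proof eventually_elim
    case (elim q)
    then show ?case
      using prod_pairs_power2_scaled[of "\<bar>ln q\<bar>" "\<lambda>k l. cmod (node \<alpha> q l - node \<alpha> q k)" r, symmetric]
      by (simp add: R_def contour_margin_eq[OF \<Gamma>])
  qed
  ultimately have "(R \<longlongrightarrow> ?C) ?F"
    by (auto simp: margin_const_def contour_dist_def intro: Lim_transform_eventually)
  then have "((\<lambda>q. R q / ?C - 1) \<longlongrightarrow> ?C / ?C - 1) ?F"
    using C by (intro tendsto_intros)
  then have "(\<lambda>q. R q / ?C - 1) \<in> o[?F](\<lambda>_. 1)"
    using C by (intro smalloI_tendsto) auto
  moreover have "\<forall>\<^sub>F q in ?F. contour_margin r w \<alpha> \<Gamma> q =
      ?C * \<bar>ln q\<bar> ^ (r * (r - 1)) * (1 + (R q / ?C - 1))"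
    using nz by eventually_elim (use C in \<open>simp add: R_def\<close>)
  ultimately show "\<exists>\<epsilon> :: real \<Rightarrow> real. \<epsilon> \<in> o[?F](\<lambda>_. 1) \<and>
      (\<forall>\<^sub>F q in ?F. contour_margin r w \<alpha> \<Gamma> q = ?C * \<bar>ln q\<bar> ^ (r * (r - 1)) * (1 + \<epsilon> q))"
    by blast
qed

end
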